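(* Let $X$ be a locally compact Hausdorff space and let $J$ be a norm-closed linear subspace of $C_0(X)$. The following assertions are equivalent: (a) $J$ is an algebra ideal in $C_0(X)$. (b) $J$ is an order ideal in $C_0(X)$. (c) There is a closed set $F\subseteq X$ such that $J=J_F^0(X)$.
   Context: $C_0(X)$ is the Banach lattice and Banach algebra of continuous real-valued functions on $X$ vanishing at infinity, with the supremum norm and pointwise operations and order. A linear subspace $Y$ of a vector lattice $E$ is an order ideal if $0\le |x|\le |y|$ with $x\in E$, $y\in Y$ implies $x\in Y$. An algebra ideal is a linear subspace closed under multiplication by elements of $C_0(X)$. For $F\subseteq X$, $J_F^0(X)=\{f\in C_0(X): f|_F\equiv 0\}$. *)

theory Defs
  imports "HOL-Analysis.Analysis"
begin

text \<open>
  The space \<open>C\<^sub>0(X)\<close> for an arbitrary (possibly empty) topological space \<open>X\<close>. As for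
  \<^const>\<open>cfunspace\<close>, a function on \<open>X\<close> is represented by a HOL function that is
  \<^const>\<open>extensional\<close> on \<open>topspace X\<close>, so that HOL equality is equality of functions on \<open>X\<close>;
  the results of pointwise operations are therefore restricted to \<open>topspace X\<close>.
\<close>

definition c0_space :: "'a topology \<Rightarrow> ('a \<Rightarrow> real) set" where
  "c0_space X =
     {f \<in> extensional (topspace X). continuous_map X euclideanreal f \<and>
        (\<forall>e>0. \<exists>K. compactin X K \<and> (\<forall>x \<in> topspace X - K. \<bar>f x\<bar> < e))}"

text \<open>The metric of the supremum norm; see \<open>mspace_c0_metric\<close> and \<open>mdist_c0_metric\<close> below.\<close>

definition c0_metric :: "'a topology \<Rightarrow> ('a \<Rightarrow> real) metric" where
  "c0_metric X = submetric (cfunspace X euclidean_metric) (c0_space X)"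

definition c0_linear_subspace :: "'a topology \<Rightarrow> ('a \<Rightarrow> real) set \<Rightarrow> bool" where
  "c0_linear_subspace X J \<longleftrightarrow>
     J \<subseteq> c0_space X \<and>
     (\<lambda>x\<in>topspace X. 0) \<in> J \<and>
     (\<forall>f\<in>J. \<forall>g\<in>J. (\<lambda>x\<in>topspace X. f x + g x) \<in> J) \<and>
     (\<forall>c. \<forall>f\<in>J. (\<lambda>x\<in>topspace X. c * f x) \<in> J)"

definition c0_algebra_ideal :: "'a topology \<Rightarrow> ('a \<Rightarrow> real) set \<Rightarrow> bool" where
  "c0_algebra_ideal X J \<longleftrightarrow>
     c0_linear_subspace X J \<and>
     (\<forall>f\<in>c0_space X. \<forall>g\<in>J. (\<lambda>x\<in>topspace X. f x * g x) \<in> J)"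

text \<open>The order and the modulus of \<open>C\<^sub>0(X)\<close> are pointwise.\<close>

definition c0_order_ideal :: "'a topology \<Rightarrow> ('a \<Rightarrow> real) set \<Rightarrow> bool" where
  "c0_order_ideal X J \<longleftrightarrow>
     c0_linear_subspace X J \<and>
     (\<forall>f\<in>c0_space X. \<forall>g\<in>J. (\<forall>x\<in>topspace X. \<bar>f x\<bar> \<le> \<bar>g x\<bar>) \<longrightarrow> f \<in> J)"

definition c0_vanishing :: "'a topology \<Rightarrow> 'a set \<Rightarrow> ('a \<Rightarrow> real) set" where
  "c0_vanishing X F = {f \<in> c0_space X. \<forall>x\<in>F. f x = 0}"

lemma c0_space_subset_cfunspace:
  fixes X :: "'a topology"
  shows "c0_space X \<subseteq> mspace (cfunspace X euclidean_metric)"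
proof
  fix f assume f: "f \<in> c0_space X"
  then have ext: "f \<in> extensional (topspace X)" and cont: "continuous_map X euclideanreal f"
    and van: "\<And>e. e > 0 \<Longrightarrow> \<exists>K. compactin X K \<and> (\<forall>x \<in> topspace X - K. \<bar>f x\<bar> < e)"
    by (auto simp: c0_space_def)
  obtain K where K: "compactin X K" "\<And>x. x \<in> topspace X - K \<Longrightarrow> \<bar>f x\<bar> < 1"
    using van[of 1] by auto
  have "compact (f ` K)"
    using image_compactin[OF K(1) cont] by simp
  then obtain B where B: "\<And>x. x \<in> K \<Longrightarrow> \<bar>f x\<bar> \<le> B"
    by (metis compact_imp_bounded bounded_iff imageI real_norm_def)
  have "\<bar>f x\<bar> \<le> max B 1" if "x \<in> topspace X" for x
    using B[of x] K(2)[of x] that by (cases "x \<in> K") auto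
  then have "bounded (f ` topspace X)"
    unfolding bounded_iff by auto
  then show "f \<in> mspace (cfunspace X euclidean_metric)"
    using ext cont by (simp add: Met_TC.fspace_def)
qed

lemma mspace_c0_metric [simp]: "mspace (c0_metric X) = c0_space X"
  using c0_space_subset_cfunspace[of X] unfolding c0_metric_def mspace_submetric by blast

lemma mdist_c0_metric:
  fixes X :: "'a topology"
  assumes "f \<in> c0_space X" "g \<in> c0_space X" "topspace X \<noteq> {}"
  shows "mdist (c0_metric X) f g = (SUP x\<in>topspace X. \<bar>f x - g x\<bar>)"
proof -
  have "f \<in> Met_TC.fspace (topspace X)" "g \<in> Met_TC.fspace (topspace X)"
    using assms(1,2) c0_space_subset_cfunspace[of X] by (auto simp: Met_TC.fspace_def)
  then show ?thesis
    using assms(3) by (simp add: c0_metric_def cfunspace_def Met_TC.fdist_def dist_real_def)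
qed

end

theory Submission
  imports Defs
begin

text \<open>
  Let \<open>F\<close> be the set of common zeros of \<open>J\<close>, and let \<open>f \<in> C\<^sub>0(X)\<close> vanish on \<open>F\<close>. The compact set
  \<open>{\<bar>f\<bar> \<ge> \<epsilon>}\<close> misses \<open>F\<close>, so by compactness a finite sum of squares (algebra ideal) or of moduli
  (order ideal) of elements of \<open>J\<close> is a nonnegative \<open>h \<in> J\<close> bounded away from \<open>0\<close> there. Both kinds
  of ideal contain \<open>f n h / (1 + n h)\<close>, which for large \<open>n\<close> is within \<open>\<epsilon>\<close> of \<open>f\<close>; as \<open>J\<close> is closed,
  it contains \<open>f\<close>.
\<close>

section \<open>Domination, level sets and sup-norm closedness in C_0(X)\<close>

lemma c0_spaceD:
  assumes "f \<in> c0_space X"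
  shows "f \<in> extensional (topspace X)" "continuous_map X euclideanreal f"
    "\<And>e. e > 0 \<Longrightarrow> \<exists>K. compactin X K \<and> (\<forall>x \<in> topspace X - K. \<bar>f x\<bar> < e)"
  using assms by (auto simp: c0_space_def)

lemma c0_space_bounded:
  assumes "f \<in> c0_space X"
  obtains B where "B > 0" "\<And>x. x \<in> topspace X \<Longrightarrow> \<bar>f x\<bar> \<le> B"
proof -
  have "bounded (f ` topspace X)"
    using assms c0_space_subset_cfunspace[of X] by (auto simp: Met_TC.fspace_def)
  then show ?thesis
    using that unfolding bounded_pos by auto
qed

text \<open>Vanishing at infinity is inherited from \<open>g\<close>: a compact set that works for
  \<open>g\<close> at a scaled tolerance works for \<open>u\<close>. This is how products and
  quotients are later seen to lie in C_0(X).\<close>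

lemma c0_space_dominated:
  assumes g: "g \<in> c0_space X" and u: "continuous_map X euclideanreal u"
    and le: "\<And>x. x \<in> topspace X \<Longrightarrow> \<bar>u x\<bar> \<le> C * \<bar>g x\<bar>"
  shows "(\<lambda>x\<in>topspace X. u x) \<in> c0_space X"
proof -
  have "continuous_map X euclideanreal (\<lambda>x\<in>topspace X. u x)"
    using u by (rule continuous_map_eq) auto
  moreover have "\<exists>K. compactin X K \<and> (\<forall>x \<in> topspace X - K. \<bar>(\<lambda>x\<in>topspace X. u x) x\<bar> < e)"
    if "e > 0" for e
  proof -
    \<comment> \<open>\<open>C\<close> may be zero or negative; \<open>D\<close> dominates it and
      can safely divide \<open>e\<close>.\<close>
    define D where "D = max C 1"
    have D: "D > 0" by (simp add: D_def)
    with that have "e / D > 0" by simp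
    then obtain K where K: "compactin X K" "\<And>x. x \<in> topspace X - K \<Longrightarrow> \<bar>g x\<bar> < e / D"
      using c0_spaceD(3)[OF g, of "e / D"] by blast
    have "\<bar>u x\<bar> < e" if "x \<in> topspace X - K" for x
    proof -
      have "\<bar>u x\<bar> \<le> C * \<bar>g x\<bar>" using le that by blast
      also have "\<dots> \<le> D * \<bar>g x\<bar>" by (simp add: D_def mult_right_mono)
      also have "\<dots> < e" using K(2)[OF that] D by (simp add: field_simps)
      finally show ?thesis .
    qed
    then show ?thesis using K(1) by auto
  qed
  ultimately show ?thesis by (simp add: c0_space_def)
qed

text \<open>The level set is closed by continuity and sits inside a compact set outside which
  \<open>f\<close> is smaller than \<open>e\<close>.\<close>

lemma compactin_c0_level_set:
  assumes f: "f \<in> c0_space X" and e: "e > 0"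
  shows "compactin X {x \<in> topspace X. \<bar>f x\<bar> \<ge> e}"
proof -
  obtain K where K: "compactin X K" "\<And>x. x \<in> topspace X - K \<Longrightarrow> \<bar>f x\<bar> < e"
    using c0_spaceD(3)[OF f e] by auto
  have "continuous_map X euclideanreal (\<lambda>x. \<bar>f x\<bar>)"
    using c0_spaceD(2)[OF f] by (rule continuous_map_real_abs)
  from closedin_continuous_map_preimage[OF this, of "{e..}"]
  have "closedin X {x \<in> topspace X. \<bar>f x\<bar> \<ge> e}" by simp
  moreover have "{x \<in> topspace X. \<bar>f x\<bar> \<ge> e} \<subseteq> K"
    using K(2) by fastforce
  ultimately show ?thesis using closed_compactin[OF K(1)] by blast
qed

lemma closedin_c0_metricD:
  assumes cl: "closedin (mtopology_of (c0_metric X)) J"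
    and J: "(\<lambda>x\<in>topspace X. 0) \<in> J" and f: "f \<in> c0_space X"
    and appr: "\<And>e. e > 0 \<Longrightarrow> \<exists>u\<in>J. \<forall>x\<in>topspace X. \<bar>f x - u x\<bar> \<le> e"
  shows "f \<in> J"
proof (cases "topspace X = {}")
  case True
  then have "f = (\<lambda>x\<in>topspace X. 0)" using c0_spaceD(1)[OF f] by (auto simp: extensional_def)
  then show ?thesis using J by simp
next
  case False
  interpret M: Metric_space "c0_space X" "mdist (c0_metric X)"
    using Metric_space_mspace_mdist[of "c0_metric X"] by simp
  have cl': "closedin M.mtopology J" using cl by (simp add: mtopology_of_def)
  show ?thesis
  proof (rule ccontr)
    assume "f \<notin> J"
    then obtain r where r: "r > 0" "disjnt J (M.mball f r)"
      using cl' f unfolding M.closedin_metric by blast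
    obtain u where u: "u \<in> J" "\<And>x. x \<in> topspace X \<Longrightarrow> \<bar>f x - u x\<bar> \<le> r / 2"
      using appr[of "r / 2"] r(1) by auto
    have uc: "u \<in> c0_space X" using u(1) cl' unfolding M.closedin_metric by blast
    \<comment> \<open>Pointwise bounds give only a non-strict bound on the supremum, so half the
      radius is used to land in the open ball.\<close>
    have "mdist (c0_metric X) f u \<le> r / 2"
      unfolding mdist_c0_metric[OF f uc False] using False u(2) by (intro cSUP_least) auto
    then have "u \<in> M.mball f r" using f uc r(1) by (simp add: M.in_mball)
    then show False using r(2) u(1) by (auto simp: disjnt_iff)
  qed
qed

section \<open>Recovering a closed subspace from its common zeros\<close>

lemma c0_linear_subspace_sum:
  assumes J: "c0_linear_subspace X J" and "finite S" "\<And>i. i \<in> S \<Longrightarrow> p i \<in> J"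
  shows "(\<lambda>x\<in>topspace X. \<Sum>i\<in>S. p i x) \<in> J"
  using assms(2,3)
proof (induction S)
  case empty
  then show ?case using J unfolding c0_linear_subspace_def sum.empty by blast
next
  case (insert i S)
  then have "(\<lambda>x\<in>topspace X. p i x + (\<lambda>x\<in>topspace X. \<Sum>i\<in>S. p i x) x) \<in> J"
    using J by (simp add: c0_linear_subspace_def)
  moreover have "(\<lambda>x\<in>topspace X. p i x + (\<lambda>x\<in>topspace X. \<Sum>i\<in>S. p i x) x)
      = (\<lambda>x\<in>topspace X. \<Sum>i\<in>insert i S. p i x)"
    using insert.hyps by (intro restrict_ext) simp
  ultimately show ?case by (simp only:)
qed

text \<open>The two closure properties required of \<open>J\<close> here are what algebra and order ideals share.\<close>

lemma closed_subspace_eq_vanishing: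
  assumes J: "c0_linear_subspace X J" and cl: "closedin (mtopology_of (c0_metric X)) J"
    and pos: "\<And>g. g \<in> J \<Longrightarrow>
      \<exists>p\<in>J. \<forall>x\<in>topspace X. p x \<ge> 0 \<and> (p x = 0 \<longleftrightarrow> g x = 0)"
    and quot: "\<And>f h. f \<in> c0_space X \<Longrightarrow> h \<in> J \<Longrightarrow> (\<And>x. x \<in> topspace X \<Longrightarrow> h x \<ge> 0) \<Longrightarrow>
      (\<lambda>x\<in>topspace X. f x * h x / (1 + h x)) \<in> J"
  shows "\<exists>F. closedin X F \<and> J = c0_vanishing X F"
proof -
  define F where "F = {x \<in> topspace X. \<forall>g\<in>J. g x = 0}"
  have Jsub: "J \<subseteq> c0_space X" and J0: "(\<lambda>x\<in>topspace X. 0) \<in> J"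
    and Jmul: "\<And>c g. g \<in> J \<Longrightarrow> (\<lambda>x\<in>topspace X. c * g x) \<in> J"
    using J unfolding c0_linear_subspace_def by blast+
  have "closedin X {x \<in> topspace X. g x = 0}" if "g \<in> J" for g
    using closedin_continuous_map_preimage[OF c0_spaceD(2), of g X "{0}"] that Jsub by auto
  \<comment> \<open>The zero function in \<open>J\<close> makes the intersected family
    nonempty.\<close>
  then have "closedin X (\<Inter>g\<in>J. {x \<in> topspace X. g x = 0})"
    using J0 by (intro closedin_Inter) auto
  moreover have "F = (\<Inter>g\<in>J. {x \<in> topspace X. g x = 0})"
    using J0 by (auto simp: F_def)
  ultimately have F: "closedin X F" by simp
  have "f \<in> J" if f: "f \<in> c0_space X" and fF: "\<And>x. x \<in> F \<Longrightarrow> f x = 0" for f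
  proof (rule closedin_c0_metricD[OF cl J0 f])
    fix e :: real assume e: "e > 0"
    define K where "K = {x \<in> topspace X. \<bar>f x\<bar> \<ge> e}"
    have K: "compactin X K" unfolding K_def by (rule compactin_c0_level_set[OF f e])
    define U where "U g = {x \<in> topspace X. g x \<in> - {0}}" for g :: "'a \<Rightarrow> real"
    have "openin X (U g)" if "g \<in> J" for g
      unfolding U_def using that Jsub
      by (intro openin_continuous_map_preimage[OF c0_spaceD(2)]) auto
    \<comment> \<open>A point of \<open>K\<close> left uncovered would be a common zero of
      \<open>J\<close>, where \<open>f\<close> vanishes, against \<bar>f\<bar> \<ge> e > 0.\<close>
    moreover have "K \<subseteq> \<Union> (U ` J)"
      using fF e by (force simp: K_def U_def F_def)
    ultimately obtain \<G> where \<G>: "finite \<G>" "\<G> \<subseteq> U ` J" "K \<subseteq> \<Union>\<G>"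
      using K unfolding compactin_def by (metis (no_types, lifting) imageE)
    obtain S where S: "S \<subseteq> J" "finite S" "\<G> = U ` S"
      using finite_subset_image[OF \<G>(1,2)] by blast
    \<comment> \<open>\<open>p g\<close> is a nonnegative substitute for \<open>g\<close> with the
      same zeros, so summing cannot cause cancellation.\<close>
    obtain p where p: "\<And>g. g \<in> J \<Longrightarrow> p g \<in> J"
      "\<And>g x. g \<in> J \<Longrightarrow> x \<in> topspace X \<Longrightarrow> p g x \<ge> 0"
      "\<And>g x. g \<in> J \<Longrightarrow> x \<in> topspace X \<Longrightarrow> p g x = 0 \<longleftrightarrow> g x = 0"
      using pos by metis
    define h where "h = (\<lambda>x\<in>topspace X. \<Sum>g\<in>S. p g x)"
    have hJ: "h \<in> J"
      unfolding h_def using S p(1) by (intro c0_linear_subspace_sum[OF J]) auto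
    have h0: "h x \<ge> 0" if "x \<in> topspace X" for x
      using that S(1) p(2) by (auto simp: h_def intro!: sum_nonneg)
    have hK: "h x > 0" if x: "x \<in> K" for x
    proof -
      have xX: "x \<in> topspace X" using x by (simp add: K_def)
      obtain g where g: "g \<in> S" "g x \<noteq> 0"
        using \<G>(3) x S(3) by (auto simp: U_def)
      have "p g x > 0" using p(2)[of g x] p(3)[of g x] g S(1) xX by force
      then have "(\<Sum>g\<in>S. p g x) > 0"
        using S g(1) p(2) xX by (intro sum_pos2[of S g]) auto
      then show ?thesis using xX by (simp add: h_def)
    qed
    \<comment> \<open>The minimum of \<open>h\<close> on the compact set \<open>K\<close> serves as
      \<open>d\<close>; for empty \<open>K\<close> any positive number does, here 1.\<close>
    have "\<exists>d>0. \<forall>x\<in>K. h x \<ge> d"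
    proof (cases "K = {}")
      case False
      have "compact (h ` K)"
        using image_compactin[OF K c0_spaceD(2)] hJ Jsub by auto
      then obtain x where "x \<in> K" "\<And>y. y \<in> K \<Longrightarrow> h x \<le> h y"
        using False compact_attains_inf[of "h ` K"] by auto
      then show ?thesis using hK by blast
    qed (auto intro: exI[of _ 1])
    then obtain d where d: "d > 0" "\<And>x. x \<in> K \<Longrightarrow> h x \<ge> d" by blast
    obtain B where B: "B > 0" "\<And>x. x \<in> topspace X \<Longrightarrow> \<bar>f x\<bar> \<le> B"
      by (rule c0_space_bounded[OF f]) blast
    \<comment> \<open>Chosen so that \<open>e * (n * d) = B\<close>, which bounds \<open>f\<close>
      everywhere.\<close>
    define n where "n = B / (e * d)"
    have n: "n > 0" using B(1) e d(1) by (simp add: n_def)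
    define k where "k = (\<lambda>x\<in>topspace X. n * h x)"
    have k0: "k x \<ge> 0" if "x \<in> topspace X" for x
      using h0 that n by (simp add: k_def)
    have "(\<lambda>x\<in>topspace X. f x * k x / (1 + k x)) \<in> J"
      using Jmul[OF hJ] by (intro quot[OF f _ k0]) (simp only: k_def)
    moreover have "\<bar>f x - f x * k x / (1 + k x)\<bar> \<le> e" if x: "x \<in> topspace X" for x
    proof -
      have "f x - f x * k x / (1 + k x) = f x / (1 + k x)"
        using k0[OF x] by (simp add: field_simps)
      then have eq: "\<bar>f x - f x * k x / (1 + k x)\<bar> = \<bar>f x\<bar> / (1 + k x)"
        using k0[OF x] by simp
      \<comment> \<open>On \<open>K\<close> the term \<open>e * k x\<close> alone is at least
        \<open>B\<close>; off \<open>K\<close> the term \<open>e\<close> alone suffices.\<close>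
      have "\<bar>f x\<bar> \<le> e * (1 + k x)"
      proof (cases "x \<in> K")
        case True
        have "\<bar>f x\<bar> \<le> e * (n * d)" using B(2)[OF x] e d(1) by (simp add: n_def)
        also have "\<dots> \<le> e * k x" using d(2)[OF True] e n x by (simp add: k_def)
        finally show ?thesis using e by (simp add: algebra_simps)
      next
        case False
        then have "\<bar>f x\<bar> \<le> e" using x by (simp add: K_def)
        moreover have "e * k x \<ge> 0" using e k0[OF x] by simp
        ultimately show ?thesis by (simp add: algebra_simps)
      qed
      then show ?thesis using k0[OF x] unfolding eq by (simp add: divide_le_eq)
    qed
    ultimately show "\<exists>u\<in>J. \<forall>x\<in>topspace X. \<bar>f x - u x\<bar> \<le> e"
      by (intro bexI[of _ "\<lambda>x\<in>topspace X. f x * k x / (1 + k x)"]) auto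
  qed
  then have "J = c0_vanishing X F"
    using Jsub by (auto simp: c0_vanishing_def F_def)
  with F show ?thesis by blast
qed

section \<open>Algebra ideals, order ideals and the converse\<close>

text \<open>Squares supply the nonnegative substitutes. The quotient is \<open>h\<close> multiplied
  by \<open>f / (1 + h)\<close>, which lies in C_0(X) because it is dominated by
  \<open>f\<close>.\<close>

lemma c0_algebra_ideal_imp_vanishing:
  assumes I: "c0_algebra_ideal X J" and cl: "closedin (mtopology_of (c0_metric X)) J"
  shows "\<exists>F. closedin X F \<and> J = c0_vanishing X F"
proof (rule closed_subspace_eq_vanishing[OF _ cl])
  show J: "c0_linear_subspace X J" using I by (simp add: c0_algebra_ideal_def)
  have mult: "(\<lambda>x\<in>topspace X. f x * g x) \<in> J" if "f \<in> c0_space X" "g \<in> J" for f g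
    using I that by (simp add: c0_algebra_ideal_def)
  have Jsub: "J \<subseteq> c0_space X" using J by (simp add: c0_linear_subspace_def)
  show "\<exists>p\<in>J. \<forall>x\<in>topspace X. p x \<ge> 0 \<and> (p x = 0 \<longleftrightarrow> g x = 0)" if "g \<in> J" for g
    using mult[of g g] that Jsub by (intro bexI[of _ "\<lambda>x\<in>topspace X. g x * g x"]) auto
  fix f h assume f: "f \<in> c0_space X" and h: "h \<in> J" and h0: "\<And>x. x \<in> topspace X \<Longrightarrow> h x \<ge> 0"
  have ne: "1 + h x \<noteq> 0" if "x \<in> topspace X" for x using h0[OF that] by linarith
  have "(\<lambda>x\<in>topspace X. f x / (1 + h x)) \<in> c0_space X"
  proof (rule c0_space_dominated[OF f, where C = 1])
    show "continuous_map X euclideanreal (\<lambda>x. f x / (1 + h x))"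
      using c0_spaceD(2)[OF f] c0_spaceD(2)[of h X] h Jsub ne
      by (intro continuous_map_real_divide continuous_map_add) auto
    show "\<bar>f x / (1 + h x)\<bar> \<le> 1 * \<bar>f x\<bar>" if "x \<in> topspace X" for x
      using h0[OF that] by (simp add: divide_le_eq mult_le_cancel_left1)
  qed
  from mult[OF this h] show "(\<lambda>x\<in>topspace X. f x * h x / (1 + h x)) \<in> J"
    by (simp cong: restrict_cong)
qed

text \<open>Moduli supply the nonnegative substitutes. The quotient is dominated by
  \<open>B * h\<close>, where \<open>B\<close> bounds \<bar>f\<bar>.\<close>

lemma c0_order_ideal_imp_vanishing:
  assumes I: "c0_order_ideal X J" and cl: "closedin (mtopology_of (c0_metric X)) J"
  shows "\<exists>F. closedin X F \<and> J = c0_vanishing X F"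
proof (rule closed_subspace_eq_vanishing[OF _ cl])
  show J: "c0_linear_subspace X J" using I by (simp add: c0_order_ideal_def)
  then have Jsub: "J \<subseteq> c0_space X"
    and Jmul: "\<And>c g. g \<in> J \<Longrightarrow> (\<lambda>x\<in>topspace X. c * g x) \<in> J"
    by (auto simp: c0_linear_subspace_def)
  \<comment> \<open>Domination by a multiple of \<bar>g\<bar> is enough, since \<open>J\<close>
    contains \<open>C * g\<close>, whose modulus is \<open>C\<close> times that of
    \<open>g\<close>.\<close>
  have dom: "(\<lambda>x\<in>topspace X. u x) \<in> J"
    if g: "g \<in> J" and u: "continuous_map X euclideanreal u" and C: "C \<ge> 0"
      and le: "\<And>x. x \<in> topspace X \<Longrightarrow> \<bar>u x\<bar> \<le> C * \<bar>g x\<bar>" for g u C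
  proof -
    have "(\<lambda>x\<in>topspace X. u x) \<in> c0_space X"
      using c0_space_dominated[OF _ u le] g Jsub by blast
    moreover have "\<forall>x\<in>topspace X. \<bar>(\<lambda>x\<in>topspace X. u x) x\<bar> \<le> \<bar>(\<lambda>x\<in>topspace X. C * g x) x\<bar>"
      using le C by (simp add: abs_mult)
    ultimately show ?thesis
      using I Jmul[OF g, of C] unfolding c0_order_ideal_def by blast
  qed
  have cont: "continuous_map X euclideanreal g" if "g \<in> J" for g
    using that Jsub c0_spaceD(2) by blast
  show "\<exists>p\<in>J. \<forall>x\<in>topspace X. p x \<ge> 0 \<and> (p x = 0 \<longleftrightarrow> g x = 0)" if g: "g \<in> J" for g
    using dom[OF g continuous_map_real_abs[OF cont[OF g]], of 1]
    by (intro bexI[of _ "\<lambda>x\<in>topspace X. \<bar>g x\<bar>"]) auto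
  fix f h assume f: "f \<in> c0_space X" and h: "h \<in> J" and h0: "\<And>x. x \<in> topspace X \<Longrightarrow> h x \<ge> 0"
  obtain B where B: "B > 0" "\<And>x. x \<in> topspace X \<Longrightarrow> \<bar>f x\<bar> \<le> B"
    by (rule c0_space_bounded[OF f]) blast
  have ne: "1 + h x \<noteq> 0" if "x \<in> topspace X" for x using h0[OF that] by linarith
  show "(\<lambda>x\<in>topspace X. f x * h x / (1 + h x)) \<in> J"
  proof (rule dom[OF h])
    show "continuous_map X euclideanreal (\<lambda>x. f x * h x / (1 + h x))"
      using c0_spaceD(2)[OF f] cont[OF h] ne
      by (intro continuous_map_real_divide continuous_map_add continuous_map_real_mult) auto
    show "\<bar>f x * h x / (1 + h x)\<bar> \<le> B * \<bar>h x\<bar>" if x: "x \<in> topspace X" for x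
    proof -
      have "\<bar>f x * h x / (1 + h x)\<bar> = \<bar>f x * h x\<bar> / (1 + h x)"
        using h0[OF x] by simp
      also have "\<dots> \<le> \<bar>f x * h x\<bar> / 1"
        using h0[OF x] by (intro divide_left_mono) auto
      also have "\<dots> \<le> B * \<bar>h x\<bar>"
        using B(2)[OF x] by (simp add: abs_mult mult_right_mono)
      finally show ?thesis .
    qed
  qed (use B(1) in simp)
qed

text \<open>Zeros on \<open>F\<close> survive multiplication and passing to a dominated function.
  Products stay in C_0(X) because one factor is bounded.\<close>

lemma c0_vanishing_imp_ideals:
  assumes J: "c0_linear_subspace X (c0_vanishing X F)" and F: "closedin X F"
  shows "c0_algebra_ideal X (c0_vanishing X F)" "c0_order_ideal X (c0_vanishing X F)"
proof -
  \<comment> \<open>Restricted functions take their intended values, and the pointwise order gives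
    information, only on \<open>topspace X\<close>.\<close>
  have FX: "x \<in> topspace X" if "x \<in> F" for x using F closedin_subset that by blast
  have "(\<lambda>x\<in>topspace X. f x * g x) \<in> c0_vanishing X F"
    if f: "f \<in> c0_space X" and g: "g \<in> c0_vanishing X F" for f g
  proof -
    have gc: "g \<in> c0_space X" using g by (simp add: c0_vanishing_def)
    obtain B where B: "\<And>x. x \<in> topspace X \<Longrightarrow> \<bar>f x\<bar> \<le> B"
      by (rule c0_space_bounded[OF f]) blast
    have "(\<lambda>x\<in>topspace X. f x * g x) \<in> c0_space X"
      using c0_spaceD(2)[OF f] c0_spaceD(2)[OF gc] B
      by (intro c0_space_dominated[OF gc, of _ B] continuous_map_real_mult)
        (auto simp: abs_mult mult_right_mono)
    then show ?thesis using g FX by (simp add: c0_vanishing_def)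
  qed
  then show "c0_algebra_ideal X (c0_vanishing X F)"
    using J by (simp add: c0_algebra_ideal_def)
  show "c0_order_ideal X (c0_vanishing X F)"
    using J FX by (fastforce simp: c0_order_ideal_def c0_vanishing_def)
qed

theorem theorem4p1:
  fixes X :: "'a topology" and J :: "('a \<Rightarrow> real) set"
  assumes "locally_compact_space X" and "Hausdorff_space X"
    and "c0_linear_subspace X J"
    and "closedin (mtopology_of (c0_metric X)) J"
  shows "(c0_algebra_ideal X J \<longleftrightarrow> c0_order_ideal X J) \<and>
         (c0_order_ideal X J \<longleftrightarrow> (\<exists>F. closedin X F \<and> J = c0_vanishing X F))"
  using c0_algebra_ideal_imp_vanishing[OF _ assms(4)] c0_order_ideal_imp_vanishing[OF _ assms(4)]
    c0_vanishing_imp_ideals assms(3) by metis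

end
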